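(* Let $0<\tau<\pi/2$, let $(\lambda(\tau),u(x,\tau))=\left(\frac{2\tau^2}{\cos^2\tau},\,2\log\frac{\cos(\tau x)}{\cos\tau}\right)$, and let $\{\mu_j\}_{j=1}^{\infty}$, $\mu_1<\mu_2<\cdots$, be the eigenvalues (depending on $\tau$) of the problem $$\varphi''-\lambda(\tau)e^{-u(x,\tau)}\varphi=-\mu\varphi\ \ (-1<x<1),\qquad \varphi(-1)=\varphi(1)=0.$$ Then the following hold: (i) For every $j\ge1$, $\mu_j>0$ and $\mu_j$ is the unique solution of $$\tan\left(\frac{\pi}{2}(j+1)-\sqrt{\mu_j}\right)=\frac{\sqrt{\mu_j}}{\tau\tan\tau}\quad\text{and}\quad\frac{\pi}{2}j<\sqrt{\mu_j}<\frac{\pi}{2}(j+1).$$ (ii) For every $j\ge 1$, the eigenfunction $\varphi_j$ corresponding to $\mu_j$ is given, up to a nonzero constant multiple, by $$\varphi_j(x)=\sqrt{\frac{\mu_j}{\tau^2}+\tan^2(\tau x)}\;\sin\left(\sqrt{\mu_j}\,x-\arctan\left(\frac{\tau\tan(\tau x)}{\sqrt{\mu_j}}\right)+\frac{\pi}{2}j\right).$$ (iii) For every $j\ge1$, $$\lim_{\tau\downarrow0}\sqrt{\mu_j}=\frac{\pi}{2}j\quad\text{and}\quad\lim_{\tau\uparrow\pi/2}\sqrt{\mu_j}=\frac{\pi}{2}(j+1).$$ (iv) Let $\varphi_j$ be the eigenfunction given exactly by the formula in (ii). For every $j\ge1$, as $\tau\uparrow\pi/2$, $$\varphi_j(x)\to\bar\varphi_j(x)\quad\text{in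 } C_{loc}((-1,1)),$$ where $$\bar\varphi_j(x)=\sqrt{(j+1)^2+\tan^2\left(\frac{\pi}{2}x\right)}\;\sin\left(\frac{\pi}{2}(j+1)x-\arctan\left(\frac{\tan\left(\frac{\pi}{2}x\right)}{j+1}\right)+\frac{\pi}{2}j\right).$$
   Context: The pairs $(\lambda(\tau),u(\cdot,\tau))$, $0<\tau<\pi/2$, are the positive solutions of $u''+\lambda e^{-u}=0$ on $(-1,1)$, $u(\pm1)=0$, with $\lambda>0$; the eigenvalue problem is its linearization at the solution. Primes denote derivatives in $x$. By classical Sturm–Liouville theory all eigenvalues are real and simple and can be listed as a strictly increasing sequence. Convergence in $C_{loc}((-1,1))$ means uniform convergence on every compact subset of $(-1,1)$. *)

theory Defs
  imports "HOL-Analysis.Analysis"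
begin

definition lam :: "real \<Rightarrow> real" where
  "lam \<tau> = 2 * \<tau>\<^sup>2 / (cos \<tau>)\<^sup>2"

definition u :: "real \<Rightarrow> real \<Rightarrow> real" where
  "u \<tau> x = 2 * ln (cos (\<tau> * x) / cos \<tau>)"

text \<open>
  Classical solutions: the equation holds pointwise on the open interval and the boundary values
  are attained continuously. Nothing is required of \<open>\<phi>\<close> outside the closed interval.
\<close>

definition is_eigenfunction :: "real \<Rightarrow> real \<Rightarrow> (real \<Rightarrow> real) \<Rightarrow> bool" where
  "is_eigenfunction \<tau> \<mu> \<phi> \<longleftrightarrow>
     continuous_on {-1..1} \<phi> \<and>
     (\<exists>\<phi>' \<phi>''. \<forall>x\<in>{-1<..<1}.
        (\<phi> has_real_derivative \<phi>' x) (at x) \<and>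
        (\<phi>' has_real_derivative \<phi>'' x) (at x) \<and>
        \<phi>'' x - lam \<tau> * exp (- u \<tau> x) * \<phi> x = - \<mu> * \<phi> x) \<and>
     \<phi> (-1) = 0 \<and> \<phi> 1 = 0 \<and>
     (\<exists>x\<in>{-1..1}. \<phi> x \<noteq> 0)"

definition is_eigenvalue :: "real \<Rightarrow> real \<Rightarrow> bool" where
  "is_eigenvalue \<tau> \<mu> \<longleftrightarrow> (\<exists>\<phi>. is_eigenfunction \<tau> \<mu> \<phi>)"

text \<open>The enumeration starts at index 1; the value at 0 is irrelevant.\<close>

definition enumerates_eigenvalues :: "real \<Rightarrow> (nat \<Rightarrow> real) \<Rightarrow> bool" where
  "enumerates_eigenvalues \<tau> m \<longleftrightarrow>
     strict_mono_on {1..} m \<and> m ` {1..} = {\<mu>. is_eigenvalue \<tau> \<mu>}"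

definition solves_char_eq :: "real \<Rightarrow> nat \<Rightarrow> real \<Rightarrow> bool" where
  "solves_char_eq \<tau> j \<mu> \<longleftrightarrow>
     tan (pi / 2 * (real j + 1) - sqrt \<mu>) = sqrt \<mu> / (\<tau> * tan \<tau>) \<and>
     pi / 2 * real j < sqrt \<mu> \<and> sqrt \<mu> < pi / 2 * (real j + 1)"

definition eigfun :: "real \<Rightarrow> nat \<Rightarrow> real \<Rightarrow> real \<Rightarrow> real" where
  "eigfun \<tau> j \<mu> x =
     sqrt (\<mu> / \<tau>\<^sup>2 + (tan (\<tau> * x))\<^sup>2) *
     sin (sqrt \<mu> * x - arctan (\<tau> * tan (\<tau> * x) / sqrt \<mu>) + pi / 2 * real j)"

definition eigfun_lim :: "nat \<Rightarrow> real \<Rightarrow> real" where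
  "eigfun_lim j x =
     sqrt ((real j + 1)\<^sup>2 + (tan (pi / 2 * x))\<^sup>2) *
     sin (pi / 2 * (real j + 1) * x - arctan (tan (pi / 2 * x) / (real j + 1)) + pi / 2 * real j)"

end

theory Submission
  imports Defs
begin

text \<open>
  Since \<open>lam \<tau> * exp (- u \<tau> x) = 2 * \<tau>\<^sup>2 / (cos (\<tau> * x))\<^sup>2\<close>, the eigenvalue problem is a Poeschl-Teller
  equation, and it is solvable in closed form. With \<open>W x = \<tau> * tan (\<tau> * x)\<close> the potential is
  \<open>2 * W'\<close>, and \<open>W' - W\<^sup>2 = \<tau>\<^sup>2\<close>. Hence, for every \<open>\<psi>\<close> with \<open>\<psi>'' = - k\<^sup>2 * \<psi>\<close>, the function
  \<open>\<psi>' + W * \<psi>\<close> solves the equation with \<open>\<mu> = k\<^sup>2\<close>. Starting from \<open>\<psi> x = - cos (k * x + b)\<close> one gets the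
  solution \<open>wave \<tau> k b\<close>, which has the polar form
  \<open>sqrt (k\<^sup>2 + (W x)\<^sup>2) * sin (k * x + b - arctan (W x / k))\<close>. The Wronskian of the solutions with
  phases \<open>b\<close> and \<open>b + pi / 2\<close> is a multiple of \<open>k * (k\<^sup>2 - \<tau>\<^sup>2)\<close>, so for \<open>k > \<tau>\<close> they span all
  solutions.

  No eigenvalue satisfies \<open>\<mu> \<le> \<tau>\<^sup>2\<close>: after division by \<open>cos (\<tau> * x)\<close> a maximum principle applies.
  For \<open>k = sqrt \<mu> > \<tau>\<close> choose the phase \<open>b\<close> so that the wave vanishes at \<open>1\<close>; then its partner with
  phase \<open>b + pi / 2\<close> does not, and an eigenfunction must be a multiple of the wave. Its value at \<open>-1\<close>
  is proportional to the sine of twice \<open>phase \<tau> k = k - arctan (\<tau> * tan \<tau> / k)\<close>. So \<open>\<mu>\<close> is an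
  eigenvalue iff \<open>phase \<tau> k = pi / 2 * n\<close> for an integer \<open>n\<close>. The phase is strictly increasing in
  \<open>k\<close> and vanishes at \<open>k = \<tau>\<close>, which gives exactly one eigenvalue for each \<open>n \<ge> 1\<close> and none for
  \<open>n \<le> 0\<close>; and \<open>phase \<tau> k = pi / 2 * n\<close> is the characteristic equation of index \<open>n\<close> in disguise.
  An increasing enumeration has to list these eigenvalues in the order of \<open>n\<close>.

  The limits of \<open>k = sqrt \<mu>\<close> follow from \<open>k = pi / 2 * j + arctan (\<tau> * tan \<tau> / k)\<close>, because
  \<open>k\<close> stays in a bounded interval away from \<open>0\<close> while \<open>\<tau> * tan \<tau>\<close> tends to \<open>0\<close> or to infinity.
  Finally the eigenfunctions depend continuously on \<open>(\<tau>, k)\<close>, uniformly for \<open>x\<close> in a compact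
  subset of the open interval, even at \<open>\<tau> = pi / 2\<close>.
\<close>

section \<open>The linearized equation\<close>

lemma cos_mult_pos:
  fixes \<tau> x :: real
  assumes "0 < \<tau>" "\<tau> < pi / 2" "x \<in> {-1..1}"
  shows "0 < cos (\<tau> * x)"
proof -
  have "\<bar>\<tau> * x\<bar> \<le> \<tau>"
    using assms mult_left_mono[of "\<bar>x\<bar>" 1 \<tau>] by (simp add: abs_mult abs_le_iff)
  then have "- (pi / 2) < \<tau> * x" "\<tau> * x < pi / 2" using assms by linarith+
  then show ?thesis by (rule cos_gt_zero_pi)
qed

lemma lam_exp_u:
  assumes "0 < \<tau>" "\<tau> < pi / 2" "x \<in> {-1..1}"
  shows "lam \<tau> * exp (- u \<tau> x) = 2 * (\<tau> / cos (\<tau> * x))\<^sup>2"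
proof -
  have c: "0 < cos (\<tau> * x)" "0 < cos \<tau>"
    using cos_mult_pos[OF assms] cos_mult_pos[OF assms(1,2), of 1] by auto
  have "u \<tau> x = ln ((cos (\<tau> * x) / cos \<tau>)\<^sup>2)"
    using c by (simp add: u_def ln_realpow)
  then have "exp (- u \<tau> x) = inverse ((cos (\<tau> * x) / cos \<tau>)\<^sup>2)"
    using c by (simp add: exp_minus)
  then show ?thesis using c by (simp add: lam_def field_simps)
qed

text \<open>
  The linearized equation as a first-order system, with the exponential coefficient evaluated.
\<close>

definition solves_lin :: "real \<Rightarrow> real \<Rightarrow> (real \<Rightarrow> real) \<Rightarrow> (real \<Rightarrow> real) \<Rightarrow> bool" where
  "solves_lin \<tau> \<mu> \<phi> \<phi>' \<longleftrightarrow> (\<forall>x\<in>{-1<..<1}.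
     (\<phi> has_real_derivative \<phi>' x) (at x) \<and>
     (\<phi>' has_real_derivative (2 * (\<tau> / cos (\<tau> * x))\<^sup>2 - \<mu>) * \<phi> x) (at x))"

lemma is_eigenfunction_iff_solves_lin:
  assumes "0 < \<tau>" "\<tau> < pi / 2"
  shows "is_eigenfunction \<tau> \<mu> \<phi> \<longleftrightarrow>
    continuous_on {-1..1} \<phi> \<and> (\<exists>\<phi>'. solves_lin \<tau> \<mu> \<phi> \<phi>') \<and> \<phi> (-1) = 0 \<and> \<phi> 1 = 0 \<and>
    (\<exists>x\<in>{-1..1}. \<phi> x \<noteq> 0)"
proof -
  have lam: "lam \<tau> * exp (- u \<tau> x) = 2 * (\<tau> / cos (\<tau> * x))\<^sup>2" if "x \<in> {-1<..<1}" for x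
    using lam_exp_u[OF assms, of x] that by auto
  have "(\<exists>\<phi>''. \<forall>x\<in>{-1<..<1}.
        (\<phi> has_real_derivative \<phi>' x) (at x) \<and> (\<phi>' has_real_derivative \<phi>'' x) (at x) \<and>
        \<phi>'' x - lam \<tau> * exp (- u \<tau> x) * \<phi> x = - \<mu> * \<phi> x) \<longleftrightarrow> solves_lin \<tau> \<mu> \<phi> \<phi>'"
    (is "(\<exists>\<phi>''. ?P \<phi>'') \<longleftrightarrow> ?Q") for \<phi>'
  proof
    assume "\<exists>\<phi>''. ?P \<phi>''"
    then obtain \<phi>'' where P: "?P \<phi>''" by blast
    have "\<phi>'' x = (2 * (\<tau> / cos (\<tau> * x))\<^sup>2 - \<mu>) * \<phi> x" if "x \<in> {-1<..<1}" for x
      using P that lam[OF that] by (auto simp: algebra_simps)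
    with P show ?Q by (auto simp: solves_lin_def)
  next
    assume ?Q
    then have "?P (\<lambda>x. (2 * (\<tau> / cos (\<tau> * x))\<^sup>2 - \<mu>) * \<phi> x)"
      using lam by (auto simp: solves_lin_def algebra_simps)
    then show "\<exists>\<phi>''. ?P \<phi>''"
      by (rule exI[of ?P "\<lambda>x. (2 * (\<tau> / cos (\<tau> * x))\<^sup>2 - \<mu>) * \<phi> x"])
  qed
  then show ?thesis unfolding is_eigenfunction_def by simp
qed

lemma solves_lin_cmult:
  "solves_lin \<tau> \<mu> \<phi> \<phi>' \<Longrightarrow> solves_lin \<tau> \<mu> (\<lambda>x. c * \<phi> x) (\<lambda>x. c * \<phi>' x)"
  unfolding solves_lin_def mult.left_commute[of _ c] by (blast intro: DERIV_cmult)

lemma solves_lin_cong: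
  assumes "solves_lin \<tau> \<mu> \<phi> \<phi>'" "\<And>x. x \<in> {-1<..<1} \<Longrightarrow> \<psi> x = \<phi> x"
  shows "solves_lin \<tau> \<mu> \<psi> \<phi>'"
  unfolding solves_lin_def
proof (intro ballI conjI)
  fix x :: real assume x: "x \<in> {-1<..<1}"
  show "(\<psi> has_real_derivative \<phi>' x) (at x)"
    by (rule has_field_derivative_transform_within_open[where f = \<phi> and S = "{-1<..<1}"])
       (use assms x in \<open>auto simp: solves_lin_def\<close>)
  show "(\<phi>' has_real_derivative (2 * (\<tau> / cos (\<tau> * x))\<^sup>2 - \<mu>) * \<psi> x) (at x)"
    using assms(1) x unfolding assms(2)[OF x] by (simp add: solves_lin_def)
qed

lemma wronskian_constant:
  assumes "solves_lin \<tau> \<mu> f f'" "solves_lin \<tau> \<mu> g g'"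
  obtains w where "\<And>x. x \<in> {-1<..<1} \<Longrightarrow> f x * g' x - f' x * g x = w"
proof -
  have "((\<lambda>x. f x * g' x - f' x * g x) has_real_derivative 0) (at x within {-1<..<1})"
    if "x \<in> {-1<..<1}" for x
  proof -
    let ?q = "2 * (\<tau> / cos (\<tau> * x))\<^sup>2 - \<mu>"
    have d: "(f has_real_derivative f' x) (at x)" "(f' has_real_derivative ?q * f x) (at x)"
      "(g has_real_derivative g' x) (at x)" "(g' has_real_derivative ?q * g x) (at x)"
      using assms that by (auto simp: solves_lin_def)
    have "((\<lambda>x. f x * g' x - f' x * g x) has_real_derivative
        (f' x * g' x + (?q * g x) * f x) - ((?q * f x) * g x + g' x * f' x)) (at x)"
      by (intro DERIV_diff DERIV_mult d)
    moreover have "(f' x * g' x + (?q * g x) * f x) - ((?q * f x) * g x + g' x * f' x) = 0"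
      by (simp add: algebra_simps)
    ultimately show ?thesis by (metis DERIV_subset subset_UNIV)
  qed
  then obtain w where "\<forall>x\<in>{-1<..<1}. f x * g' x - f' x * g x = w"
    using has_field_derivative_zero_constant[of "{-1<..<1::real}"] by blast
  then show ?thesis using that by blast
qed

section \<open>Eigenvalues exceed the square of the parameter\<close>

text \<open>
  The quotient \<open>g x = \<phi> x / cos (\<tau> * x)\<close> cannot have a positive interior maximum. Indeed
  \<open>P = (cos (\<tau> * x))\<^sup>2 * g'\<close> satisfies
  \<open>P' = (2 * (\<tau> / cos (\<tau> * x))\<^sup>2 + \<tau>\<^sup>2 - \<mu>) * cos (\<tau> * x) * \<phi> x\<close>, which is positive wherever \<open>\<phi>\<close> is. At a
  positive maximum \<open>P\<close> vanishes, so \<open>g\<close> would increase to the right of it.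
\<close>

lemma solves_lin_nonpos:
  assumes \<tau>: "0 < \<tau>" "\<tau> < pi / 2" and \<mu>: "\<mu> \<le> \<tau>\<^sup>2"
    and cont: "continuous_on {-1..1} \<phi>" and sol: "solves_lin \<tau> \<mu> \<phi> \<phi>'"
    and bd: "\<phi> (-1) = 0" "\<phi> 1 = 0" and x: "x \<in> {-1..1}"
  shows "\<phi> x \<le> 0"
proof (rule ccontr)
  assume pos: "\<not> \<phi> x \<le> 0"
  define g where "g = (\<lambda>x. \<phi> x / cos (\<tau> * x))"
  define P where "P = (\<lambda>x. \<phi>' x * cos (\<tau> * x) + \<tau> * \<phi> x * sin (\<tau> * x))"
  have c: "0 < cos (\<tau> * y)" if "y \<in> {-1..1}" for y
    using cos_mult_pos[OF \<tau>, of y] that by auto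
  have "continuous_on {-1..1} g" unfolding g_def
    using c by (intro continuous_intros cont) force
  then obtain m where m: "m \<in> {-1..1}" "\<And>y. y \<in> {-1..1} \<Longrightarrow> g y \<le> g m"
    using continuous_attains_sup[of "{-1..1::real}" g] by force
  have "0 < g x" using pos c[OF x] by (simp add: g_def)
  with m(2)[OF x] have gm: "0 < g m" by linarith
  then have "\<phi> m > 0" using c[OF m(1)] by (simp add: g_def zero_less_divide_iff)
  with m(1) bd have mi: "m \<in> {-1<..<1}" by (cases "m = 1"; cases "m = -1") auto
  have dg: "(g has_real_derivative P y / (cos (\<tau> * y))\<^sup>2) (at y)" if "y \<in> {-1<..<1}" for y
  proof -
    have "cos (\<tau> * y) \<noteq> 0" using c[of y] that by auto
    moreover have "(\<phi> has_real_derivative \<phi>' y) (at y)" using sol that by (auto simp: solves_lin_def)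
    ultimately show ?thesis unfolding g_def P_def
      by (auto intro!: derivative_eq_intros simp: field_simps power2_eq_square)
  qed
  have "(P has_real_derivative (2 * (\<tau> / cos (\<tau> * m))\<^sup>2 + \<tau>\<^sup>2 - \<mu>) * cos (\<tau> * m) * \<phi> m) (at m)"
  proof -
    have "(\<phi> has_real_derivative \<phi>' m) (at m)"
      "(\<phi>' has_real_derivative (2 * (\<tau> / cos (\<tau> * m))\<^sup>2 - \<mu>) * \<phi> m) (at m)"
      using sol mi by (auto simp: solves_lin_def)
    then show ?thesis unfolding P_def
      by (auto intro!: derivative_eq_intros simp: algebra_simps power2_eq_square)
  qed
  moreover have "(2 * (\<tau> / cos (\<tau> * m))\<^sup>2 + \<tau>\<^sup>2 - \<mu>) * cos (\<tau> * m) * \<phi> m > 0"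
  proof -
    have "2 * (\<tau> / cos (\<tau> * m))\<^sup>2 > 0" using \<tau> c[OF m(1)] by simp
    then have "2 * (\<tau> / cos (\<tau> * m))\<^sup>2 + \<tau>\<^sup>2 - \<mu> > 0" using \<mu> by linarith
    then show ?thesis using c[OF m(1)] \<open>\<phi> m > 0\<close> by simp
  qed
  ultimately obtain d where d: "d > 0" "\<And>h. 0 < h \<Longrightarrow> h < d \<Longrightarrow> P m < P (m + h)"
    using DERIV_pos_inc_right[of P _ m] by blast
  have Pm: "P m = 0"
  proof -
    have "P m / (cos (\<tau> * m))\<^sup>2 = 0"
    proof (rule DERIV_local_max[OF dg[OF mi], of "min (m + 1) (1 - m)"])
      show "\<forall>y. \<bar>m - y\<bar> < min (m + 1) (1 - m) \<longrightarrow> g y \<le> g m"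
        by (intro allI impI m(2)) auto
    qed (use mi in auto)
    then show ?thesis using c[OF m(1)] by simp
  qed
  define h where "h = min d (1 - m) / 2"
  have h: "0 < h" "h < d" "m + h < 1" using d(1) mi by (auto simp: h_def min_def field_simps)
  have "g m < g (m + h)"
  proof (rule DERIV_pos_imp_increasing_open[of m "m + h" g])
    show "m < m + h" using h by simp
    fix y assume y: "m < y" "y < m + h"
    then have yi: "y \<in> {-1<..<1}" using mi h by auto
    have "P y > 0" using d(2)[of "y - m"] y h Pm by auto
    then show "\<exists>l. (g has_real_derivative l) (at y) \<and> l > 0"
      using dg[OF yi] c[of y] yi by (intro exI[of _ "P y / (cos (\<tau> * y))\<^sup>2"]) auto
  next
    show "continuous_on {m..m + h} g"
      by (rule continuous_on_subset[OF \<open>continuous_on {-1..1} g\<close>]) (use mi h in auto)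
  qed
  with m(2)[of "m + h"] mi h show False by auto
qed

lemma eigenvalue_gt:
  assumes \<tau>: "0 < \<tau>" "\<tau> < pi / 2" and "is_eigenfunction \<tau> \<mu> \<phi>"
  shows "\<tau>\<^sup>2 < \<mu>"
proof (rule ccontr)
  assume "\<not> \<tau>\<^sup>2 < \<mu>"
  then have \<mu>: "\<mu> \<le> \<tau>\<^sup>2" by simp
  obtain \<phi>' x where \<phi>: "continuous_on {-1..1} \<phi>" "solves_lin \<tau> \<mu> \<phi> \<phi>'" "\<phi> (-1) = 0" "\<phi> 1 = 0"
    and x: "x \<in> {-1..1}" "\<phi> x \<noteq> 0"
    using assms(3) unfolding is_eigenfunction_iff_solves_lin[OF \<tau>] by blast
  have "\<phi> x \<le> 0" by (rule solves_lin_nonpos[OF \<tau> \<mu> \<phi> x(1)])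
  moreover have "-1 * \<phi> x \<le> 0"
    by (rule solves_lin_nonpos[OF \<tau> \<mu> _ solves_lin_cmult[OF \<phi>(2)] _ _ x(1)])
       (use \<phi> in \<open>auto intro: continuous_intros\<close>)
  ultimately show False using x(2) by simp
qed

section \<open>Explicit solutions\<close>

definition wave :: "real \<Rightarrow> real \<Rightarrow> real \<Rightarrow> real \<Rightarrow> real" where
  "wave \<tau> k b x = k * sin (k * x + b) - \<tau> * tan (\<tau> * x) * cos (k * x + b)"

definition wave' :: "real \<Rightarrow> real \<Rightarrow> real \<Rightarrow> real \<Rightarrow> real" where
  "wave' \<tau> k b x = (k\<^sup>2 - (\<tau> / cos (\<tau> * x))\<^sup>2) * cos (k * x + b)
     + k * \<tau> * tan (\<tau> * x) * sin (k * x + b)"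

lemma solves_lin_wave:
  assumes \<tau>: "0 < \<tau>" "\<tau> < pi / 2"
  shows "solves_lin \<tau> (k\<^sup>2) (wave \<tau> k b) (wave' \<tau> k b)"
  unfolding solves_lin_def
proof (intro ballI conjI)
  fix x :: real assume "x \<in> {-1<..<1}"
  then have c: "cos (\<tau> * x) \<noteq> 0" using cos_mult_pos[OF \<tau>, of x] by auto
  have W: "((\<lambda>x. \<tau> * tan (\<tau> * x)) has_real_derivative (\<tau> / cos (\<tau> * x))\<^sup>2) (at x)"
    using c by (auto intro!: derivative_eq_intros simp: field_simps power2_eq_square)
  have D: "((\<lambda>x. (\<tau> / cos (\<tau> * x))\<^sup>2) has_real_derivative
      2 * (\<tau> * tan (\<tau> * x)) * (\<tau> / cos (\<tau> * x))\<^sup>2) (at x)"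
    using c by (auto intro!: derivative_eq_intros simp: tan_def field_simps power2_eq_square)
  have S: "((\<lambda>x. sin (k * x + b)) has_real_derivative k * cos (k * x + b)) (at x)"
    and C: "((\<lambda>x. cos (k * x + b)) has_real_derivative - (k * sin (k * x + b))) (at x)"
    by (auto intro!: derivative_eq_intros)
  show "(wave \<tau> k b has_real_derivative wave' \<tau> k b x) (at x)"
    unfolding wave_def wave'_def
    by (rule DERIV_cong[OF DERIV_diff[OF DERIV_cmult[OF S] DERIV_mult[OF W C]]])
       (simp add: algebra_simps power2_eq_square)
  show "(wave' \<tau> k b has_real_derivative (2 * (\<tau> / cos (\<tau> * x))\<^sup>2 - k\<^sup>2) * wave \<tau> k b x) (at x)"
    unfolding wave_def wave'_def mult.assoc[of k \<tau>]
    by (rule DERIV_cong[OF DERIV_add[OF DERIV_mult[OF DERIV_diff[OF DERIV_const D] C]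
          DERIV_mult[OF DERIV_cmult[OF W] S]]])
       (simp add: algebra_simps power2_eq_square)
qed

lemma continuous_on_wave:
  assumes \<tau>: "0 < \<tau>" "\<tau> < pi / 2"
  shows "continuous_on {-1..1} (wave \<tau> k b)"
proof -
  have "cos (\<tau> * x) \<noteq> 0" if "x \<in> {-1..1}" for x
    using cos_mult_pos[OF \<tau>, of x] that by simp
  then show ?thesis unfolding wave_def by (auto intro!: continuous_intros)
qed

lemma wave_wronskian:
  assumes "cos (\<tau> * x) \<noteq> 0"
  shows "wave' \<tau> k b x * wave \<tau> k (b + pi / 2) x - wave \<tau> k b x * wave' \<tau> k (b + pi / 2) x
    = k * (k\<^sup>2 - \<tau>\<^sup>2)"
proof -
  define S C W D where "S = sin (k * x + b)" and "C = cos (k * x + b)"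
    and "W = \<tau> * tan (\<tau> * x)" and "D = (\<tau> / cos (\<tau> * x))\<^sup>2"
  have sc: "sin (k * x + (b + pi / 2)) = C" "cos (k * x + (b + pi / 2)) = - S"
    by (simp_all add: S_def C_def sin_add cos_add)
  have "S\<^sup>2 + C\<^sup>2 = 1" by (simp add: S_def C_def)
  moreover have "D = \<tau>\<^sup>2 + W\<^sup>2"
    using tan_sec[OF assms] by (simp add: D_def W_def divide_inverse power_mult_distrib
        flip: distrib_left[of "\<tau>\<^sup>2" 1, simplified])
  moreover have "((k\<^sup>2 - D) * C + k * W * S) * (k * C - W * - S)
      - (k * S - W * C) * ((k\<^sup>2 - D) * - S + k * W * C) = k * (k\<^sup>2 - D + W\<^sup>2) * (S\<^sup>2 + C\<^sup>2)"
    by (simp add: algebra_simps power2_eq_square)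
  moreover have "wave \<tau> k b x = k * S - W * C" "wave' \<tau> k b x = (k\<^sup>2 - D) * C + k * W * S"
    "wave \<tau> k (b + pi / 2) x = k * C - W * - S"
    "wave' \<tau> k (b + pi / 2) x = (k\<^sup>2 - D) * - S + k * W * C"
    by (simp_all add: wave_def wave'_def sc) (simp_all add: S_def C_def W_def D_def)
  ultimately show ?thesis by simp
qed

text \<open>
  An eigenfunction is not assumed to have a derivative at the endpoints, so a Wronskian cannot be
  evaluated there. Writing it as a combination of two waves on the open interval and extending
  this by continuity avoids the problem.
\<close>

lemma solves_lin_span:
  assumes \<tau>: "0 < \<tau>" "\<tau> < pi / 2" and k: "\<tau> < k"
    and cont: "continuous_on {-1..1} \<phi>" and sol: "solves_lin \<tau> (k\<^sup>2) \<phi> \<phi>'"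
  obtains a c where "\<And>x. x \<in> {-1..1} \<Longrightarrow> \<phi> x = a * wave \<tau> k b x + c * wave \<tau> k (b + pi / 2) x"
proof -
  define w where "w = k * (k\<^sup>2 - \<tau>\<^sup>2)"
  have "w \<noteq> 0" using \<tau> k power_strict_mono[of \<tau> k 2] by (simp add: w_def)
  let ?F = "wave \<tau> k b" and ?E = "wave \<tau> k (b + pi / 2)"
  obtain \<alpha> where \<alpha>: "\<And>x. x \<in> {-1<..<1} \<Longrightarrow> \<phi> x * wave' \<tau> k b x - \<phi>' x * ?F x = \<alpha>"
    using wronskian_constant[OF sol solves_lin_wave[OF \<tau>]] by blast
  obtain \<beta> where \<beta>: "\<And>x. x \<in> {-1<..<1} \<Longrightarrow> \<phi> x * wave' \<tau> k (b + pi / 2) x - \<phi>' x * ?E x = \<beta>"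
    using wronskian_constant[OF sol solves_lin_wave[OF \<tau>]] by blast
  define h where "h = (\<lambda>x. \<phi> x - ((- \<beta> / w) * ?F x + (\<alpha> / w) * ?E x))"
  have "h x = 0" if "x \<in> {-1<..<1}" for x
  proof -
    have "cos (\<tau> * x) \<noteq> 0" using cos_mult_pos[OF \<tau>, of x] that by auto
    from wave_wronskian[OF this, of k b]
    have "\<phi> x * w = \<phi> x * (wave' \<tau> k b x * ?E x - ?F x * wave' \<tau> k (b + pi / 2) x)"
      by (simp add: w_def)
    also have "\<dots> = \<alpha> * ?E x - \<beta> * ?F x"
      unfolding \<alpha>[OF that, symmetric] \<beta>[OF that, symmetric] by (simp add: algebra_simps)
    finally show ?thesis using \<open>w \<noteq> 0\<close> by (simp add: h_def field_simps)
  qed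
  moreover have "continuous_on (closure {-1<..<1}) h"
    unfolding h_def
    by (use \<open>w \<noteq> 0\<close> in \<open>auto intro!: continuous_intros cont continuous_on_wave \<tau>\<close>)
  ultimately have "h x = 0" if "x \<in> closure {-1<..<1}" for x
    using continuous_constant_on_closure[of "{-1<..<1::real}" h 0 x] that by blast
  then have "h x = 0" if "x \<in> {-1..1}" for x using that by simp
  then show ?thesis by (intro that[of "- \<beta> / w" "\<alpha> / w"]) (simp add: h_def)
qed

lemma wave_polar:
  assumes "0 < k"
  shows "wave \<tau> k b x
    = sqrt (k\<^sup>2 + (\<tau> * tan (\<tau> * x))\<^sup>2) * sin (k * x - arctan (\<tau> * tan (\<tau> * x) / k) + b)"
proof -
  define W where "W = \<tau> * tan (\<tau> * x)"
  define r where "r = sqrt (k\<^sup>2 + W\<^sup>2)"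
  have "r > 0" using assms by (simp add: r_def add_pos_nonneg)
  have "sqrt (1 + (W / k)\<^sup>2) = sqrt ((k\<^sup>2 + W\<^sup>2) / k\<^sup>2)"
    using assms by (simp add: field_simps)
  also have "\<dots> = r / k" using assms by (simp add: r_def real_sqrt_divide)
  finally have "sqrt (1 + (W / k)\<^sup>2) = r / k" .
  then have "sin (arctan (W / k)) = W / r" "cos (arctan (W / k)) = k / r"
    using assms by (simp_all add: sin_arctan cos_arctan)
  moreover have "k * x - arctan (W / k) + b = (k * x + b) - arctan (W / k)" by simp
  ultimately have "r * sin (k * x - arctan (W / k) + b) = k * sin (k * x + b) - W * cos (k * x + b)"
    using \<open>r > 0\<close> by (simp only: sin_diff) (simp add: field_simps)
  then show ?thesis by (simp add: wave_def W_def r_def)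
qed

lemma eigfun_eq_wave:
  assumes "0 < \<tau>" "0 < \<mu>"
  shows "eigfun \<tau> j \<mu> x = wave \<tau> (sqrt \<mu>) (pi / 2 * real j) x / \<tau>"
proof -
  have "\<mu> / \<tau>\<^sup>2 + (tan (\<tau> * x))\<^sup>2 = ((sqrt \<mu>)\<^sup>2 + (\<tau> * tan (\<tau> * x))\<^sup>2) / \<tau>\<^sup>2"
    using assms by (simp add: field_simps)
  then have "sqrt (\<mu> / \<tau>\<^sup>2 + (tan (\<tau> * x))\<^sup>2) = sqrt ((sqrt \<mu>)\<^sup>2 + (\<tau> * tan (\<tau> * x))\<^sup>2) / \<tau>"
    using assms by (simp only: real_sqrt_divide) simp
  then show ?thesis using assms by (simp add: eigfun_def wave_polar[of "sqrt \<mu>"])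
qed

section \<open>The phase at the endpoint and the characteristic equation\<close>

definition phase :: "real \<Rightarrow> real \<Rightarrow> real" where
  "phase \<tau> k = k - arctan (\<tau> * tan \<tau> / k)"

lemma mult_tan_pos: "0 < \<tau> \<Longrightarrow> \<tau> < pi / 2 \<Longrightarrow> 0 < \<tau> * tan \<tau>"
  by (simp add: tan_gt_zero)

lemma wave_endpoints:
  assumes "0 < k"
  shows "wave \<tau> k b 1 = sqrt (k\<^sup>2 + (\<tau> * tan \<tau>)\<^sup>2) * sin (b + phase \<tau> k)"
    and "wave \<tau> k b (-1) = sqrt (k\<^sup>2 + (\<tau> * tan \<tau>)\<^sup>2) * sin (b - phase \<tau> k)"
proof -
  have *: "k * 1 - arctan (\<tau> * tan (\<tau> * 1) / k) + b = b + phase \<tau> k"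
    "k * -1 - arctan (\<tau> * tan (\<tau> * -1) / k) + b = b - phase \<tau> k"
    by (simp_all add: phase_def arctan_minus)
  show "wave \<tau> k b 1 = sqrt (k\<^sup>2 + (\<tau> * tan \<tau>)\<^sup>2) * sin (b + phase \<tau> k)"
    unfolding wave_polar[OF assms] * by simp
  show "wave \<tau> k b (-1) = sqrt (k\<^sup>2 + (\<tau> * tan \<tau>)\<^sup>2) * sin (b - phase \<tau> k)"
    unfolding wave_polar[OF assms] * by simp
qed

lemma phase_strict_mono:
  assumes "0 < \<tau>" "\<tau> < pi / 2" "0 < k" "k < l"
  shows "phase \<tau> k < phase \<tau> l"
proof -
  have "\<tau> * tan \<tau> / l < \<tau> * tan \<tau> / k"
    using assms mult_tan_pos[of \<tau>] by (intro divide_strict_left_mono) auto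
  then have "arctan (\<tau> * tan \<tau> / l) < arctan (\<tau> * tan \<tau> / k)" by (rule arctan_monotone)
  with assms show ?thesis by (simp add: phase_def)
qed

lemma phase_less_iff:
  assumes "0 < \<tau>" "\<tau> < pi / 2" "0 < k" "0 < l"
  shows "phase \<tau> k < phase \<tau> l \<longleftrightarrow> k < l"
  using phase_strict_mono[of \<tau> k l] phase_strict_mono[of \<tau> l k] assms
  by (cases k l rule: linorder_cases) auto

lemma phase_self: "0 < \<tau> \<Longrightarrow> \<tau> < pi / 2 \<Longrightarrow> phase \<tau> \<tau> = 0"
  by (simp add: phase_def arctan_tan)

lemma phase_surj:
  assumes \<tau>: "0 < \<tau>" "\<tau> < pi / 2" and y: "0 < y"
  obtains k where "0 < k" "phase \<tau> k = y"
proof -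
  have T: "0 < \<tau> * tan \<tau> / l" if "0 < l" for l using mult_tan_pos[OF \<tau>] that by simp
  have "phase \<tau> y \<le> y" using T[OF y] by (simp add: phase_def)
  moreover have "y \<le> phase \<tau> (y + pi / 2)"
    using arctan_ubound[of "\<tau> * tan \<tau> / (y + pi / 2)"] by (simp add: phase_def)
  moreover have "continuous_on {y..y + pi / 2} (phase \<tau>)"
    unfolding phase_def using y by (auto intro!: continuous_intros)
  ultimately obtain k where "y \<le> k" "phase \<tau> k = y"
    using IVT'[of "phase \<tau>" y y "y + pi / 2"] by auto
  with y show ?thesis by (intro that[of k]) auto
qed

text \<open>
  Both sides say \<open>arctan (\<tau> * tan \<tau> / k) = k - pi / 2 * j\<close> for \<open>k = sqrt \<mu>\<close>; the bounds on \<open>k\<close> in the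
  characteristic equation merely select the principal branch of the tangent.
\<close>

lemma solves_char_eq_iff_phase:
  assumes \<tau>: "0 < \<tau>" "\<tau> < pi / 2"
  shows "solves_char_eq \<tau> j \<mu> \<longleftrightarrow> 0 < \<mu> \<and> phase \<tau> (sqrt \<mu>) = pi / 2 * real j"
proof -
  define k T where "k = sqrt \<mu>" and "T = \<tau> * tan \<tau>"
  have T: "T > 0" using mult_tan_pos[OF \<tau>] by (simp add: T_def)
  have k: "0 < \<mu> \<longleftrightarrow> 0 < k" by (simp add: k_def)
  have inv: "arctan (T / k) = pi / 2 - arctan (k / T)" if "0 < k"
    using that T arctan_inverse[of "k / T"] by (simp add: inverse_eq_divide)
  have "solves_char_eq \<tau> j \<mu> \<longleftrightarrow> 0 < k \<and> pi / 2 * (real j + 1) - k = arctan (k / T)"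
    (is "?l \<longleftrightarrow> ?r")
  proof
    assume ?l
    then have *: "tan (pi / 2 * (real j + 1) - k) = k / T" "pi / 2 * real j < k"
      "k < pi / 2 * (real j + 1)"
      by (auto simp: solves_char_eq_def k_def T_def)
    have "0 \<le> pi / 2 * real j" by simp
    with *(2) have "0 < k" by linarith
    moreover have "arctan (k / T) = pi / 2 * (real j + 1) - k"
      by (rule arctan_unique) (use * in \<open>auto simp: algebra_simps\<close>)
    ultimately show ?r by simp
  next
    assume r: ?r
    then have "0 < arctan (k / T)" "arctan (k / T) < pi / 2"
      using T arctan_ubound[of "k / T"] by auto
    moreover have "tan (pi / 2 * (real j + 1) - k) = k / T" using r by (simp add: tan_arctan)
    ultimately show ?l
      using r by (auto simp: solves_char_eq_def algebra_simps simp flip: k_def T_def)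
  qed
  also have "\<dots> \<longleftrightarrow> 0 < k \<and> phase \<tau> k = pi / 2 * real j"
    using inv by (auto simp: phase_def algebra_simps simp flip: T_def)
  finally show ?thesis by (simp add: k flip: k_def)
qed

section \<open>Eigenfunctions and eigenvalues\<close>

text \<open>
  Since \<open>sin (b + phase \<tau> k) = 0\<close>, the wave with phase \<open>b\<close> vanishes at \<open>1\<close>, whereas its partner with
  phase \<open>b + pi / 2\<close> has a cosine in place of the sine and does not. So the boundary condition at \<open>1\<close>
  removes the partner.
\<close>

lemma eigenfunction_eq_wave:
  assumes \<tau>: "0 < \<tau>" "\<tau> < pi / 2" and eig: "is_eigenfunction \<tau> (k\<^sup>2) \<phi>" and k: "0 < k"
    and b: "sin (b + phase \<tau> k) = 0"
  obtains a where "a \<noteq> 0" "\<And>x. x \<in> {-1..1} \<Longrightarrow> \<phi> x = a * wave \<tau> k b x"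
proof -
  have "\<tau> < k" using eigenvalue_gt[OF \<tau> eig] k by (simp add: power_less_imp_less_base)
  obtain \<phi>' x where \<phi>: "continuous_on {-1..1} \<phi>" "solves_lin \<tau> (k\<^sup>2) \<phi> \<phi>'" "\<phi> 1 = 0"
    and x: "x \<in> {-1..1}" "\<phi> x \<noteq> 0"
    using eig unfolding is_eigenfunction_iff_solves_lin[OF \<tau>] by blast
  obtain a c where ac: "\<And>x. x \<in> {-1..1} \<Longrightarrow> \<phi> x = a * wave \<tau> k b x + c * wave \<tau> k (b + pi / 2) x"
    using solves_lin_span[OF \<tau> \<open>\<tau> < k\<close> \<phi>(1,2)] by blast
  have "cos (b + phase \<tau> k) \<noteq> 0" using b sin_zero_abs_cos_one by fastforce
  moreover have "sin (b + pi / 2 + phase \<tau> k) = cos (b + phase \<tau> k)"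
    using sin_add[of "b + phase \<tau> k" "pi / 2"] by (simp add: add_ac)
  moreover have "sqrt (k\<^sup>2 + (\<tau> * tan \<tau>)\<^sup>2) \<noteq> 0"
    using k by (simp add: sum_power2_eq_zero_iff)
  ultimately have "wave \<tau> k b 1 = 0" "wave \<tau> k (b + pi / 2) 1 \<noteq> 0"
    using b k by (simp_all add: wave_endpoints)
  with ac[of 1] \<phi>(3) have "c = 0" by simp
  with ac x have "a \<noteq> 0" by auto
  with ac \<open>c = 0\<close> that show ?thesis by simp
qed

lemma is_eigenfunction_iff_eigfun:
  assumes \<tau>: "0 < \<tau>" "\<tau> < pi / 2" and \<mu>: "0 < \<mu>" and ph: "phase \<tau> (sqrt \<mu>) = pi / 2 * real j"
    and j: "1 \<le> j"
  shows "is_eigenfunction \<tau> \<mu> \<phi> \<longleftrightarrow> (\<exists>c. c \<noteq> 0 \<and> (\<forall>x\<in>{-1..1}. \<phi> x = c * eigfun \<tau> j \<mu> x))"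
proof
  define k b where "k = sqrt \<mu>" and "b = pi / 2 * real j"
  have k: "0 < k" "\<mu> = k\<^sup>2" using \<mu> by (auto simp: k_def)
  have "b + phase \<tau> k = real j * pi" "b - phase \<tau> k = 0"
    using ph by (simp_all add: k_def b_def field_simps)
  then have b: "sin (b + phase \<tau> k) = 0" "sin (b - phase \<tau> k) = 0" by simp_all
  have eig: "eigfun \<tau> j \<mu> x = wave \<tau> k b x / \<tau>" for x
    using \<tau> \<mu> by (simp add: eigfun_eq_wave k_def b_def)
  {
    assume "is_eigenfunction \<tau> \<mu> \<phi>"
    then obtain a where "a \<noteq> 0" "\<And>x. x \<in> {-1..1} \<Longrightarrow> \<phi> x = a * wave \<tau> k b x"
      using eigenfunction_eq_wave[OF \<tau> _ k(1) b(1)] k(2) by blast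
    then show "\<exists>c. c \<noteq> 0 \<and> (\<forall>x\<in>{-1..1}. \<phi> x = c * eigfun \<tau> j \<mu> x)"
      using \<tau> by (intro exI[of _ "a * \<tau>"]) (auto simp: eig)
  }
  assume "\<exists>c. c \<noteq> 0 \<and> (\<forall>x\<in>{-1..1}. \<phi> x = c * eigfun \<tau> j \<mu> x)"
  then obtain c where c: "c \<noteq> 0" "\<And>x. x \<in> {-1..1} \<Longrightarrow> \<phi> x = (c / \<tau>) * wave \<tau> k b x"
    by (auto simp: eig)
  show "is_eigenfunction \<tau> \<mu> \<phi>"
    unfolding is_eigenfunction_iff_solves_lin[OF \<tau>]
  proof (intro conjI)
    show "continuous_on {-1..1} \<phi>"
      by (subst continuous_on_cong[OF refl c(2)])
         (simp, intro continuous_on_mult_left continuous_on_wave \<tau>)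
    have "solves_lin \<tau> \<mu> \<phi> (\<lambda>x. (c / \<tau>) * wave' \<tau> k b x)"
      unfolding k(2)
      by (rule solves_lin_cong[OF solves_lin_cmult[OF solves_lin_wave[OF \<tau>]]]) (use c(2) in auto)
    then show "\<exists>\<phi>'. solves_lin \<tau> \<mu> \<phi> \<phi>'" by blast
    show "\<phi> (-1) = 0" "\<phi> 1 = 0" using c(2) b k(1) by (auto simp: wave_endpoints)
    (* A wave vanishing identically would contradict the Wronskian identity at 0, as \<tau> < k. *)
    have "\<tau> < k"
      using phase_less_iff[OF \<tau> \<tau>(1) k(1)] phase_self[OF \<tau>] ph j by (simp add: k_def)
    show "\<exists>x\<in>{-1..1}. \<phi> x \<noteq> 0"
    proof (rule ccontr)
      assume "\<not> ?thesis"
      then have z: "wave \<tau> k b x = 0" if "x \<in> {-1..1}" for x using c \<tau> that by auto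
      have "(wave \<tau> k b has_real_derivative wave' \<tau> k b 0) (at 0)"
        using solves_lin_wave[OF \<tau>, of k b] by (simp add: solves_lin_def)
      moreover have "(wave \<tau> k b has_real_derivative 0) (at 0)"
        by (rule has_field_derivative_transform_within_open[where f = "\<lambda>_. 0" and S = "{-1<..<1}"])
           (use z in auto)
      ultimately have "wave' \<tau> k b 0 = 0" by (rule DERIV_unique)
      with wave_wronskian[of \<tau> 0 k b] z[of 0] have "k * (k\<^sup>2 - \<tau>\<^sup>2) = 0" by simp
      with \<open>\<tau> < k\<close> \<tau> k power_strict_mono[of \<tau> k 2] show False by simp
    qed
  qed
qed

lemma is_eigenvalue_iff_phase:
  assumes \<tau>: "0 < \<tau>" "\<tau> < pi / 2"
  shows "is_eigenvalue \<tau> \<mu> \<longleftrightarrow> (\<exists>n\<ge>1. 0 < \<mu> \<and> phase \<tau> (sqrt \<mu>) = pi / 2 * real n)"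
proof
  assume "is_eigenvalue \<tau> \<mu>"
  then obtain \<phi> where eig: "is_eigenfunction \<tau> \<mu> \<phi>" by (auto simp: is_eigenvalue_def)
  have gt: "\<tau>\<^sup>2 < \<mu>" by (rule eigenvalue_gt[OF \<tau> eig])
  then have \<mu>: "0 < \<mu>" using zero_le_power2[of \<tau>] by linarith
  define k where "k = sqrt \<mu>"
  have k: "0 < k" "\<mu> = k\<^sup>2" using \<mu> by (auto simp: k_def)
  have "\<tau> < k" using gt k by (simp add: power_less_imp_less_base)
  then have "0 < phase \<tau> k" using phase_strict_mono[OF \<tau> \<tau>(1)] phase_self[OF \<tau>] by force
  (* This choice of b makes the wave vanish at 1. *)
  obtain a where a: "a \<noteq> 0" "\<And>x. x \<in> {-1..1} \<Longrightarrow> \<phi> x = a * wave \<tau> k (- phase \<tau> k) x"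
    using eigenfunction_eq_wave[OF \<tau> _ k(1), of \<phi> "- phase \<tau> k"] eig k(2) by auto
  have "\<phi> (-1) = 0" using eig by (simp add: is_eigenfunction_def)
  with a have "wave \<tau> k (- phase \<tau> k) (-1) = 0" by simp
  moreover have "sqrt (k\<^sup>2 + (\<tau> * tan \<tau>)\<^sup>2) \<noteq> 0"
    using k by (simp add: sum_power2_eq_zero_iff)
  ultimately have "sin (- (2 * phase \<tau> k)) = 0"
    using k by (simp add: wave_endpoints)
  then have "sin (2 * phase \<tau> k) = 0" by (simp only: sin_minus)
  then obtain i :: int where i: "2 * phase \<tau> k = of_int i * pi"
    unfolding sin_zero_iff_int2 by blast
  with \<open>0 < phase \<tau> k\<close> have "0 < of_int i * pi" by linarith
  then have "0 < i" by (simp add: zero_less_mult_iff)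
  then show "\<exists>n\<ge>1. 0 < \<mu> \<and> phase \<tau> (sqrt \<mu>) = pi / 2 * real n"
    using i \<mu> by (intro exI[of _ "nat i"]) (auto simp: k_def mult.commute)
next
  assume "\<exists>n\<ge>1. 0 < \<mu> \<and> phase \<tau> (sqrt \<mu>) = pi / 2 * real n"
  then obtain n where n: "1 \<le> n" "0 < \<mu>" "phase \<tau> (sqrt \<mu>) = pi / 2 * real n" by blast
  have "is_eigenfunction \<tau> \<mu> (eigfun \<tau> n \<mu>)"
    using is_eigenfunction_iff_eigfun[OF \<tau> n(2,3,1)] by (auto intro: exI[of _ 1])
  then show "is_eigenvalue \<tau> \<mu>" by (auto simp: is_eigenvalue_def)
qed

lemma strict_mono_onto_eq_id:
  fixes N :: "nat \<Rightarrow> nat"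
  assumes mono: "strict_mono_on {1..} N" and onto: "N ` {1..} = {1..}" and "1 \<le> i"
  shows "N i = i"
  using \<open>1 \<le> i\<close>
proof (induction i rule: less_induct)
  case (less i)
  obtain p where p: "1 \<le> p" "N p = i" using onto less.prems by (metis atLeast_iff imageE)
  have "\<not> p < i" using less.IH[of p] p by auto
  moreover have False if "i < p"
  proof -
    have "N i < i" using strict_mono_onD[OF mono, of i p] that p less.prems by auto
    moreover have "1 \<le> N i" using onto less.prems by auto
    ultimately have "N (N i) = N i" using less.IH by blast
    with strict_mono_onD[OF mono, of "N i" i] \<open>N i < i\<close> \<open>1 \<le> N i\<close> less.prems show False by auto
  qed
  ultimately show ?case using p by (metis linorder_neqE_nat)
qed

text \<open>
  The index \<open>n\<close> of \<open>phase \<tau> (sqrt \<mu>) = pi / 2 * n\<close> is an order isomorphism from the set of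
  eigenvalues onto the positive integers. Composed with an increasing enumeration, it becomes an
  increasing surjection of the positive integers, hence the identity.
\<close>

lemma phase_of_enumerated_eigenvalue:
  assumes \<tau>: "0 < \<tau>" "\<tau> < pi / 2" and enum: "enumerates_eigenvalues \<tau> m" and j: "1 \<le> j"
  shows "0 < m j" "phase \<tau> (sqrt (m j)) = pi / 2 * real j"
proof -
  have mono: "strict_mono_on {1..} m" and im: "m ` {1..} = {\<mu>. is_eigenvalue \<tau> \<mu>}"
    using enum by (auto simp: enumerates_eigenvalues_def)
  have "\<exists>n\<ge>1. 0 < m i \<and> phase \<tau> (sqrt (m i)) = pi / 2 * real n" if "1 \<le> i" for i
    using im that is_eigenvalue_iff_phase[OF \<tau>, of "m i"] by auto
  then obtain N where N: "\<And>i. 1 \<le> i \<Longrightarrow>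
      1 \<le> N i \<and> 0 < m i \<and> phase \<tau> (sqrt (m i)) = pi / 2 * real (N i)" by metis
  have "strict_mono_on {1..} N"
  proof (rule strict_mono_onI)
    fix r s :: nat assume rs: "r \<in> {1..}" "s \<in> {1..}" "r < s"
    then have "m r < m s" using mono by (simp add: strict_mono_onD)
    then have "phase \<tau> (sqrt (m r)) < phase \<tau> (sqrt (m s))"
      using N[of r] rs by (intro phase_strict_mono \<tau>) auto
    then show "N r < N s" using N[of r] N[of s] rs by simp
  qed
  moreover have "N ` {1..} = {1..}"
  proof
    show "N ` {1..} \<subseteq> {1..}" using N by auto
    show "{1..} \<subseteq> N ` {1..}"
    proof
      fix n :: nat assume n: "n \<in> {1..}"
      then obtain k where k: "0 < k" "phase \<tau> k = pi / 2 * real n"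
        using phase_surj[OF \<tau>, of "pi / 2 * real n"] by auto
      then have "is_eigenvalue \<tau> (k\<^sup>2)" using n unfolding is_eigenvalue_iff_phase[OF \<tau>] by auto
      then obtain i where i: "1 \<le> i" "m i = k\<^sup>2" using im by (metis imageE atLeast_iff mem_Collect_eq)
      then have "N i = n" using N[OF i(1)] k by simp
      then show "n \<in> N ` {1..}" using i by auto
    qed
  qed
  ultimately have "N j = j" using j by (rule strict_mono_onto_eq_id)
  then show "0 < m j" "phase \<tau> (sqrt (m j)) = pi / 2 * real j" using N[OF j] by auto
qed

section \<open>Limits\<close>

lemma phase_level_tendsto_at_right_0:
  assumes j: "1 \<le> j"
    and k: "\<And>\<tau>. 0 < \<tau> \<Longrightarrow> \<tau> < pi / 2 \<Longrightarrow> 0 < k \<tau> \<and> phase \<tau> (k \<tau>) = pi / 2 * real j"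
  shows "(k \<longlongrightarrow> pi / 2 * real j) (at_right 0)"
proof (rule tendsto_sandwich)
  let ?l = "pi / 2 * real j"
  have l: "0 < ?l" using j by simp
  have *: "?l \<le> k \<tau> \<and> k \<tau> \<le> ?l + \<tau> * tan \<tau> / ?l" if "0 < \<tau>" "\<tau> < pi / 2" for \<tau>
  proof -
    have T: "0 < \<tau> * tan \<tau>" using mult_tan_pos that by blast
    have eq: "k \<tau> = ?l + arctan (\<tau> * tan \<tau> / k \<tau>)" and pos: "0 < k \<tau>"
      using k[OF that] by (auto simp: phase_def)
    then have "0 < arctan (\<tau> * tan \<tau> / k \<tau>)" using T by simp
    with eq have lk: "?l \<le> k \<tau>" by linarith
    have "arctan (\<tau> * tan \<tau> / k \<tau>) \<le> \<tau> * tan \<tau> / k \<tau>"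
      using T pos by (intro arctan_le_self) simp
    also have "\<dots> \<le> \<tau> * tan \<tau> / ?l" using T l lk by (intro divide_left_mono) auto
    finally show ?thesis using eq lk by linarith
  qed
  have ev: "\<forall>\<^sub>F \<tau> in at_right 0. 0 < \<tau> \<and> \<tau> < pi / 2"
    unfolding eventually_at_right_field by (intro exI[of _ "pi / 2"]) auto
  show "\<forall>\<^sub>F \<tau> in at_right 0. ?l \<le> k \<tau>" by (rule eventually_mono[OF ev]) (use * in auto)
  show "\<forall>\<^sub>F \<tau> in at_right 0. k \<tau> \<le> ?l + \<tau> * tan \<tau> / ?l"
    by (rule eventually_mono[OF ev]) (use * in auto)
  show "((\<lambda>\<tau>. ?l + \<tau> * tan \<tau> / ?l) \<longlongrightarrow> ?l) (at_right 0)"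
    using l by (auto intro!: tendsto_eq_intros)
qed (rule tendsto_const)

lemma phase_level_bounds:
  assumes \<tau>: "0 < \<tau>" "\<tau> < pi / 2" and k: "0 < k" "phase \<tau> k = pi / 2 * real j"
  shows "pi / 2 * real j < k" "k < pi / 2 * (real j + 1)"
  using solves_char_eq_iff_phase[OF \<tau>, of j "k\<^sup>2"] k by (auto simp: solves_char_eq_def)

lemma phase_level_tendsto_at_left_pi_half:
  assumes k: "\<And>\<tau>. 0 < \<tau> \<Longrightarrow> \<tau> < pi / 2 \<Longrightarrow> 0 < k \<tau> \<and> phase \<tau> (k \<tau>) = pi / 2 * real j"
  shows "(k \<longlongrightarrow> pi / 2 * (real j + 1)) (at_left (pi / 2))"
proof (rule tendsto_sandwich)
  let ?r = "pi / 2 * (real j + 1)"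
  have r: "0 < ?r" by (simp add: add_nonneg_pos)
  have *: "pi / 2 * real j + arctan (\<tau> * tan \<tau> / ?r) \<le> k \<tau> \<and> k \<tau> \<le> ?r"
    if "0 < \<tau>" "\<tau> < pi / 2" for \<tau>
  proof -
    have T: "0 < \<tau> * tan \<tau>" using mult_tan_pos that by blast
    have eq: "k \<tau> = pi / 2 * real j + arctan (\<tau> * tan \<tau> / k \<tau>)" and pos: "0 < k \<tau>"
      using k[OF that] by (auto simp: phase_def)
    have kr: "k \<tau> \<le> ?r" using phase_level_bounds(2)[OF that, of "k \<tau>" j] k[OF that] by simp
    have "\<tau> * tan \<tau> / ?r \<le> \<tau> * tan \<tau> / k \<tau>" using T r pos kr by (intro divide_left_mono) auto
    then have "arctan (\<tau> * tan \<tau> / ?r) \<le> arctan (\<tau> * tan \<tau> / k \<tau>)" by (rule arctan_monotone')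
    with eq kr show ?thesis by linarith
  qed
  have ev: "\<forall>\<^sub>F \<tau> in at_left (pi / 2). 0 < \<tau> \<and> \<tau> < pi / 2"
    unfolding eventually_at_left_field by (intro exI[of _ 0]) auto
  show "\<forall>\<^sub>F \<tau> in at_left (pi / 2). pi / 2 * real j + arctan (\<tau> * tan \<tau> / ?r) \<le> k \<tau>"
    by (rule eventually_mono[OF ev]) (use * in auto)
  show "\<forall>\<^sub>F \<tau> in at_left (pi / 2). k \<tau> \<le> ?r" by (rule eventually_mono[OF ev]) (use * in auto)
  have "filterlim (\<lambda>\<tau>. (\<tau> / ?r) * tan \<tau>) at_top (at_left (pi / 2))"
    by (rule filterlim_tendsto_pos_mult_at_top[where c = "(pi / 2) / ?r"])
       (use r in \<open>auto intro!: tendsto_eq_intros filterlim_tan_at_left\<close>)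
  then have "((\<lambda>\<tau>. arctan ((\<tau> / ?r) * tan \<tau>)) \<longlongrightarrow> pi / 2) (at_left (pi / 2))"
    by (rule filterlim_compose[OF tendsto_arctan_at_top])
  then have "((\<lambda>\<tau>. pi / 2 * real j + arctan (\<tau> * tan \<tau> / ?r)) \<longlongrightarrow> pi / 2 * real j + pi / 2)
      (at_left (pi / 2))"
    unfolding times_divide_eq_left by (intro tendsto_intros)
  moreover have "pi / 2 * real j + pi / 2 = ?r" by (simp add: field_simps)
  ultimately show "((\<lambda>\<tau>. pi / 2 * real j + arctan (\<tau> * tan \<tau> / ?r)) \<longlongrightarrow> ?r) (at_left (pi / 2))"
    by (simp only:)
qed (rule tendsto_const)

text \<open>
  Joint continuity of \<open>eigfun\<close> in \<open>\<tau>\<close>, \<open>sqrt \<mu>\<close> and \<open>x\<close>, for \<open>x\<close> in a compact set, gives continuity in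
  the parameters uniformly in \<open>x\<close>. It holds up to \<open>\<tau> = pi / 2\<close>
  because \<open>\<bar>\<tau> * x\<bar> < pi / 2\<close> as soon as \<open>\<bar>x\<bar> < 1\<close>.
\<close>

lemma eigfun_uniform_limit:
  assumes lim: "((\<lambda>\<tau>. sqrt (m \<tau>)) \<longlongrightarrow> pi / 2 * (real j + 1)) (at_left (pi / 2))"
    and K: "compact K" "K \<subseteq> {-1<..<1}"
  shows "uniform_limit K (\<lambda>\<tau>. eigfun \<tau> j (m \<tau>)) (eigfun_lim j) (at_left (pi / 2))"
proof (rule uniform_limitI)
  fix e :: real assume "0 < e"
  define U :: "(real \<times> real) set" where "U = {0<..pi / 2} \<times> {0<..}"
  define p0 where "p0 = (pi / 2, pi / 2 * (real j + 1))"
  define H where "H = (\<lambda>(p, x). eigfun (fst p) j ((snd p)\<^sup>2) x)"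
  have "p0 \<in> U" by (auto simp: p0_def U_def add_nonneg_pos)
  have cos: "cos (t * x) \<noteq> 0" if "0 < t" "t \<le> pi / 2" "x \<in> K" for t x
  proof -
    have "x \<in> {-1<..<1}" using that K by blast
    then have "\<bar>x\<bar> < 1" by auto
    then have "t * \<bar>x\<bar> < t" using that by simp
    moreover have "\<bar>t * x\<bar> = t * \<bar>x\<bar>" using that by (simp add: abs_mult)
    ultimately have "\<bar>t * x\<bar> < pi / 2" using that by linarith
    then have "0 < cos (t * x)" by (intro cos_gt_zero_pi) auto
    then show ?thesis by simp
  qed
  have tan: "continuous_on (U \<times> K) (\<lambda>z. tan (fst (fst z) * snd z))"
  proof (rule continuous_on_compose2[where g = tan])
    show "continuous_on {y :: real. cos y \<noteq> 0} tan" by (intro continuous_intros) auto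
    show "continuous_on (U \<times> K) (\<lambda>z. fst (fst z) * snd z)" by (intro continuous_intros)
    show "(\<lambda>z. fst (fst z) * snd z) ` (U \<times> K) \<subseteq> {y. cos y \<noteq> 0}"
    proof (intro image_subsetI CollectI)
      fix z assume "z \<in> U \<times> K"
      then have "0 < fst (fst z)" "fst (fst z) \<le> pi / 2" "snd z \<in> K" by (auto simp: U_def)
      then show "cos (fst (fst z) * snd z) \<noteq> 0" by (rule cos)
    qed
  qed
  have H: "continuous_on (U \<times> K) H"
    unfolding H_def eigfun_def case_prod_unfold
    by (intro continuous_intros tan) (auto simp: U_def)
  have "0 < e / 2" using \<open>0 < e\<close> by simp
  from continuous_on_prod_compactE[OF H K(1) \<open>p0 \<in> U\<close> this]
  obtain V where V: "p0 \<in> V" "open V"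
    "\<forall>p\<in>V \<inter> U. \<forall>x\<in>K. dist (H (p, x)) (H (p0, x)) \<le> e / 2"
    by blast
  have "((\<lambda>\<tau>. (\<tau>, sqrt (m \<tau>))) \<longlongrightarrow> p0) (at_left (pi / 2))"
    unfolding p0_def by (intro tendsto_Pair lim tendsto_ident_at)
  then have "\<forall>\<^sub>F \<tau> in at_left (pi / 2). (\<tau>, sqrt (m \<tau>)) \<in> V"
    using V by (auto dest: topological_tendstoD)
  moreover have "\<forall>\<^sub>F \<tau> in at_left (pi / 2). 0 < sqrt (m \<tau>)"
    using lim by (rule order_tendstoD) (simp add: add_nonneg_pos)
  moreover have "\<forall>\<^sub>F \<tau> in at_left (pi / 2). 0 < \<tau> \<and> \<tau> < pi / 2"
    unfolding eventually_at_left_field by (intro exI[of _ 0]) auto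
  ultimately show "\<forall>\<^sub>F \<tau> in at_left (pi / 2). \<forall>x\<in>K. dist (eigfun \<tau> j (m \<tau>) x) (eigfun_lim j x) < e"
  proof eventually_elim
    case (elim \<tau>)
    then have "(\<tau>, sqrt (m \<tau>)) \<in> V \<inter> U" by (auto simp: U_def)
    then have *: "\<forall>x\<in>K. dist (H ((\<tau>, sqrt (m \<tau>)), x)) (H (p0, x)) \<le> e / 2" by (rule bspec[OF V(3)])
    have "H ((\<tau>, sqrt (m \<tau>)), x) = eigfun \<tau> j (m \<tau>) x" for x
      using elim by (simp add: H_def)
    moreover have "(pi * (real j + 1) / 2)\<^sup>2 / (pi / 2)\<^sup>2 = (real j + 1)\<^sup>2"
      by (simp add: power_divide power_mult_distrib)
    then have "H (p0, x) = eigfun_lim j x" for x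
      by (simp add: H_def p0_def eigfun_def eigfun_lim_def)
    ultimately show ?case using * \<open>0 < e\<close> by force
  qed
qed

theorem theorem6p1:
  fixes \<mu> :: "real \<Rightarrow> nat \<Rightarrow> real"
  assumes "\<And>\<tau>. 0 < \<tau> \<Longrightarrow> \<tau> < pi / 2 \<Longrightarrow> enumerates_eigenvalues \<tau> (\<mu> \<tau>)"
  shows
    "(\<forall>\<tau> j. 0 < \<tau> \<and> \<tau> < pi / 2 \<and> 1 \<le> j \<longrightarrow>
        0 < \<mu> \<tau> j \<and> solves_char_eq \<tau> j (\<mu> \<tau> j) \<and>
        (\<forall>\<nu>. solves_char_eq \<tau> j \<nu> \<longrightarrow> \<nu> = \<mu> \<tau> j)) \<and>
     (\<forall>\<tau> j. 0 < \<tau> \<and> \<tau> < pi / 2 \<and> 1 \<le> j \<longrightarrow>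
        (\<forall>\<phi>. is_eigenfunction \<tau> (\<mu> \<tau> j) \<phi> \<longleftrightarrow>
             (\<exists>c. c \<noteq> 0 \<and> (\<forall>x\<in>{-1..1}. \<phi> x = c * eigfun \<tau> j (\<mu> \<tau> j) x)))) \<and>
     (\<forall>j\<ge>1.
        ((\<lambda>\<tau>. sqrt (\<mu> \<tau> j)) \<longlongrightarrow> pi / 2 * real j) (at_right 0) \<and>
        ((\<lambda>\<tau>. sqrt (\<mu> \<tau> j)) \<longlongrightarrow> pi / 2 * (real j + 1)) (at_left (pi / 2))) \<and>
     (\<forall>j\<ge>1. \<forall>K. compact K \<and> K \<subseteq> {-1<..<1} \<longrightarrow>
        uniform_limit K (\<lambda>\<tau>. eigfun \<tau> j (\<mu> \<tau> j)) (eigfun_lim j) (at_left (pi / 2)))"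
proof -
  have ph: "0 < \<mu> \<tau> j" "phase \<tau> (sqrt (\<mu> \<tau> j)) = pi / 2 * real j"
    if "0 < \<tau>" "\<tau> < pi / 2" "1 \<le> j" for \<tau> j
    using phase_of_enumerated_eigenvalue[OF that(1,2) assms that(3)] that by auto
  have uniq: "\<nu> = \<mu> \<tau> j"
    if \<tau>: "0 < \<tau>" "\<tau> < pi / 2" and j: "1 \<le> j" and \<nu>: "solves_char_eq \<tau> j \<nu>" for \<tau> j \<nu>
  proof -
    have "0 < \<nu>" "phase \<tau> (sqrt \<nu>) = phase \<tau> (sqrt (\<mu> \<tau> j))"
      using \<nu> ph[OF \<tau> j] by (auto simp: solves_char_eq_iff_phase[OF \<tau>])
    then have "\<not> sqrt \<nu> < sqrt (\<mu> \<tau> j)" "\<not> sqrt (\<mu> \<tau> j) < sqrt \<nu>"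
      using phase_less_iff[OF \<tau>] ph[OF \<tau> j] by (metis less_irrefl real_sqrt_gt_0_iff)+
    then show ?thesis by simp
  qed
  have lim: "((\<lambda>\<tau>. sqrt (\<mu> \<tau> j)) \<longlongrightarrow> pi / 2 * real j) (at_right 0)"
    "((\<lambda>\<tau>. sqrt (\<mu> \<tau> j)) \<longlongrightarrow> pi / 2 * (real j + 1)) (at_left (pi / 2))" if "1 \<le> j" for j
    by (rule phase_level_tendsto_at_right_0 phase_level_tendsto_at_left_pi_half; use ph that in simp)+
  show ?thesis
  proof (intro conjI allI impI; (elim conjE)?)
    fix \<tau> :: real and j :: nat assume a: "0 < \<tau>" "\<tau> < pi / 2" "1 \<le> j"
    show "0 < \<mu> \<tau> j" by (rule ph(1)[OF a])
    show "solves_char_eq \<tau> j (\<mu> \<tau> j)" using ph[OF a] by (simp add: solves_char_eq_iff_phase[OF a(1,2)])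
    show "\<nu> = \<mu> \<tau> j" if "solves_char_eq \<tau> j \<nu>" for \<nu> by (rule uniq[OF a that])
    show "is_eigenfunction \<tau> (\<mu> \<tau> j) \<phi> \<longleftrightarrow>
        (\<exists>c. c \<noteq> 0 \<and> (\<forall>x\<in>{-1..1}. \<phi> x = c * eigfun \<tau> j (\<mu> \<tau> j) x))" for \<phi>
      by (rule is_eigenfunction_iff_eigfun[OF a(1,2) ph[OF a] a(3)])
  qed (rule lim eigfun_uniform_limit[OF lim(2)] | assumption)+
qed

end
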